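(* Let $\overline x_n=(x_{n,1},\dots,x_{n,n})$ be the vector of zeros of $S_n$. Suppose that for all $k=1,\dots,n$: 1. $\dfrac{\partial E}{\partial\omega_k}(\overline x_n)=0$; 2. $\dfrac{\partial^2V_n}{\partial\omega_k^2}(\overline x_n)=\dfrac{\partial^2F}{\partial\omega_k^2}(\overline x_n)+\dfrac{\partial^2G}{\partial\omega_k^2}(\overline x_n)>0$. Then $\overline x_n$ is a local minimum of the energy $E(\overline\omega)$.
   Context: Let $\alpha,\beta>-1$, $d\mu^{\alpha,\beta}(x)=(1-x)^\alpha(1+x)^\beta dx$ on $[-1,1]$; $P_n=P_n^{\alpha,\beta}$ are the monic Jacobi polynomials, $h_n=\int_{-1}^1P_n^2d\mu^{\alpha,\beta}$. Let $c_1,\dots,c_N\in\mathbb R\setminus(-1,1)$ be distinct, $d_1\le\dots\le d_N$ nonnegative integers, $\lambda_{j,k}\ge0$ ($1\le j\le N$, $0\le k\le d_j$), $I_+=\{(j,k):\lambda_{j,k}>0\}$ with $(j,d_j)\in I_+$ for all $j$, and $d=\sum_j(d_j+1)$. Consider $$\langle f,g\rangle_{\mathsf s}=\int_{-1}^1fg\,d\mu^{\alpha,\beta}+\sum_{(j,k)\in I_+}\lambda_{j,k}f^{(k)}(c_j)g^{(k)}(c_j).$$ This inner product is assumed sequentially ordered: the pairs $(c_j,i)$ with $\lambda_{j,i}>0$ can be arranged as a sequence $(r_1,\nu_1),\dots,(r_M,\nu_M)$ with $\nu_1\le\dots\le\nu_M$ and $r_k$ not in the interior of the convex hull of $(-1,1)\cup\{r_1,\dots,r_{k-1}\}$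 for each $k$ (consequently only $\lambda_{j,d_j}$ is nonzero for each $j$). $S_n$ is the monic polynomial of degree $n$ with $\langle x^i,S_n\rangle_{\mathsf s}=0$ for $0\le i<n$. Fix $n\ge2$ such that the zeros $x_{n,1}<\dots<x_{n,n}$ of $S_n$ are real and simple. Notation. $Q_k(x,y;f)=\sum_{\nu=0}^k\frac{f^{(\nu)}(y)}{\nu!}(x-y)^\nu$; $\rho(x)=\prod_j(x-c_j)^{d_j+1}$; $\rho_{j,k}(x)=\rho(x)/(x-c_j)^{k+1}$; $\rho_N(x)=\prod_j(x-c_j)$; $\rho_{d-N}(x)=\prod_j(x-c_j)^{d_j}$. For $m\ge1$: $$\gamma_{1,m}=\tfrac{\beta^2-\alpha^2}{(2m+\alpha+\beta)(2m+\alpha+\beta+2)},\quad\gamma_{2,m}=\tfrac{4m(m+\alpha)(m+\beta)(m+\alpha+\beta)}{(2m+\alpha+\beta)^2((2m+\alpha+\beta)^2-1)},$$ $$\widehat a_m(x)=-\tfrac{m((2m+\alpha+\beta)x+\beta-\alpha)}{2m+\alpha+\beta},\quad\widehat b_m=\tfrac{4m(m+\alpha)(m+\beta)(m+\alpha+\beta)}{(2m+\alpha+\beta)^2(2m+\alpha+\beta-1)},$$ $$\widehat c_m(x)=\tfrac{(m+\alpha+\beta)((2m+\alpha+\beta)x+\alpha-\beta)}{2m+\alpha+\beta},\quad\widehat d_m=-(2m+\alpha+\beta-1)$$ (for $m=1$ cancel the factor $1+\alpha+\beta$ in $\gamma_{2,1},\widehat b_1$); $$A_{2,m}=\rho-\sum_{(j,k)\in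 I_+}\tfrac{k!\lambda_{j,k}S_m^{(k)}(c_j)}{h_{m-1}}Q_k(x,c_j;P_{m-1})\rho_{j,k},\quad B_{2,m}=\sum_{(j,k)\in I_+}\tfrac{k!\lambda_{j,k}S_m^{(k)}(c_j)}{h_{m-1}}Q_k(x,c_j;P_m)\rho_{j,k},$$ $$A_{3,m}=(1-x^2)A_{2,m}'+\widehat a_mA_{2,m}+\widehat d_mB_{2,m},\quad B_{3,m}=(1-x^2)B_{2,m}'+\widehat b_mA_{2,m}+\widehat c_mB_{2,m}.$$ For $i\in\{2,3\}$: $C_{i,n}=-B_{i,n-1}/\gamma_{2,n-1}$, $D_{i,n}=A_{i,n-1}+B_{i,n-1}(x-\gamma_{1,n-1})/\gamma_{2,n-1}$. Put $\Delta_n=A_{2,n}D_{2,n}-C_{2,n}B_{2,n}$, $\delta_n=\Delta_n/\rho$ (a polynomial of degree $d$), and define $\varphi_{1,n}=(B_{3,n}A_{2,n}-A_{3,n}B_{2,n})/\rho_{d-N}$, $\varphi_{2,n}=(B_{3,n}C_{2,n}-A_{3,n}D_{2,n})/\rho_{d-N}$, $\varphi_{3,n}=(B_{2,n}C_{3,n}-A_{2,n}D_{3,n})/\rho_{d-N}$ (polynomials; $\deg\varphi_{1,n}=d+N$). Put $q_{0,n}=(1-x^2)\Delta_n$, $q_{1,n}=B_{3,n}A_{2,n}-A_{3,n}B_{2,n}$, $q_{2,n}=(1-x^2)\rho'\delta_n+B_{3,n}C_{2,n}-A_{3,n}D_{2,n}$, $q_{3,n}=(1-x^2)\rho'\delta_n+C_{3,n}B_{2,n}-D_{3,n}A_{2,n}$,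 $\mathfrak P_{2,n}=q_{1,n}q_{0,n}^2$, $\mathfrak P_{1,n}=q_{0,n}(q_{1,n}q_{2,n}+q_{1,n}q_{3,n}+q_{0,n}'q_{1,n}-q_{0,n}q_{1,n}')$. Standing assumptions. (1) The zeros $u_1,\dots,u_d$ of $\delta_n$ are real, simple and different from every $x_{n,k}$. (2) $\varphi_{1,n}(x)=\kappa_1\prod_{j=1}^{N_1}(x-e_j)^{\ell_{5,j}}$ with $e_j\in\mathbb C$ outside the convex hull of $[-1,1]\cup\{c_1,\dots,c_N\}$ and $\sum_j\ell_{5,j}=d+N$. (3) $$\frac{\mathfrak P_{1,n}(x)}{\mathfrak P_{2,n}(x)}=\frac{\ell_1}{x-1}+\frac{\ell_2}{x+1}+\sum_{j=1}^N\frac{\ell_{3,j}}{x-c_j}+\sum_{j=1}^d\frac{\ell_{4,j}}{x-u_j}-\sum_{j=1}^{N_1}\frac{\ell_{5,j}}{x-e_j}$$ with $\ell_1,\ell_2,\ell_{3,j},\ell_{4,j}\ge0$; here, with $\psi_1=\varphi_{2,n}+\varphi_{3,n}$, $\psi_2=(1-x^2)\rho_N\delta_n$ and $r=\psi_1/\psi_2'$ (when the zeros of $\psi_2$ are simple), $\ell_1=1+r(1)$, $\ell_2=1+r(-1)$, $\ell_{3,j}=2d_j+r(c_j)+3$, $\ell_{4,j}=r(u_j)+1$. Energy. For $\overline\omega=(\omega_1,\dots,\omega_n)\in\mathbb R^n$, $$E(\overline\omega)=\sum_{1\le k<j\le n}\log\frac1{|\omega_j-\omega_k|}+V_n(\overline\omega),\qquad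 V_n=F+G,$$ $$F(\overline\omega)=\frac12\sum_{k=1}^n\Bigl(\log\frac1{|1-\omega_k|^{\ell_1}}+\log\frac1{|1+\omega_k|^{\ell_2}}+\sum_{j=1}^N\log\frac1{|c_j-\omega_k|^{\ell_{3,j}}}\Bigr),$$ $$G(\overline\omega)=\frac12\sum_{k=1}^n\Bigl(\sum_{j=1}^d\log\frac1{|u_j-\omega_k|^{\ell_{4,j}}}+\sum_{j=1}^{N_1}\log|e_j-\omega_k|^{\ell_{5,j}}\Bigr).$$ *)

theory Defs
  imports "HOL-Analysis.Analysis" "HOL-Computational_Algebra.Computational_Algebra"
begin

(* The points, derivative orders and masses are indexed from 1; only the values
   at 1 <= j <= num D and 0 <= k <= ord_at D j are used. *)
record sobolev_data =
  alpha :: real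
  beta :: real
  num :: nat
  pt :: "nat \<Rightarrow> real"
  ord_at :: "nat \<Rightarrow> nat"
  mass :: "nat \<Rightarrow> nat \<Rightarrow> real"

definition I_plus :: "sobolev_data \<Rightarrow> (nat \<times> nat) set" where
  "I_plus D = {(j, k). 1 \<le> j \<and> j \<le> num D \<and> k \<le> ord_at D j \<and> mass D j k > 0}"

definition total_order :: "sobolev_data \<Rightarrow> nat" where
  "total_order D = (\<Sum>j=1..num D. ord_at D j + 1)"

definition jacobi_measure :: "sobolev_data \<Rightarrow> real measure" where
  "jacobi_measure D = density lborel
     (\<lambda>x. ennreal (indicator {-1..1} x * ((1 - x) powr alpha D * (1 + x) powr beta D)))"

definition jacobi_ip :: "sobolev_data \<Rightarrow> real poly \<Rightarrow> real poly \<Rightarrow> real" where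
  "jacobi_ip D f g = (\<integral>x. poly f x * poly g x \<partial>jacobi_measure D)"

definition sobolev_ip :: "sobolev_data \<Rightarrow> real poly \<Rightarrow> real poly \<Rightarrow> real" where
  "sobolev_ip D f g = jacobi_ip D f g +
     (\<Sum>(j, k)\<in>I_plus D. mass D j k * poly ((pderiv ^^ k) f) (pt D j)
                                      * poly ((pderiv ^^ k) g) (pt D j))"

definition monic_orthogonal :: "(real poly \<Rightarrow> real poly \<Rightarrow> real) \<Rightarrow> nat \<Rightarrow> real poly" where
  "monic_orthogonal ip n =
     (THE p. degree p = n \<and> lead_coeff p = 1 \<and> (\<forall>i<n. ip (monom 1 i) p = 0))"

definition jacobi_P :: "sobolev_data \<Rightarrow> nat \<Rightarrow> real poly" where
  "jacobi_P D = monic_orthogonal (jacobi_ip D)"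

definition sobolev_S :: "sobolev_data \<Rightarrow> nat \<Rightarrow> real poly" where
  "sobolev_S D = monic_orthogonal (sobolev_ip D)"

definition jacobi_h :: "sobolev_data \<Rightarrow> nat \<Rightarrow> real" where
  "jacobi_h D n = jacobi_ip D (jacobi_P D n) (jacobi_P D n)"

(* The list rs is the arrangement (r_1, nu_1), ..., (r_M, nu_M), here with
   indices starting at 0; interior is taken in the real line. *)
definition sequentially_ordered :: "sobolev_data \<Rightarrow> bool" where
  "sequentially_ordered D \<longleftrightarrow>
     (\<exists>rs :: (real \<times> nat) list.
        distinct rs \<and> set rs = (\<lambda>(j, k). (pt D j, k)) ` I_plus D \<and>
        sorted (map snd rs) \<and>
        (\<forall>k<length rs. fst (rs ! k) \<notin>
           interior (convex hull ({-1<..<1} \<union> fst ` set (take k rs)))))"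

definition taylor :: "nat \<Rightarrow> real \<Rightarrow> real poly \<Rightarrow> real poly" where
  "taylor k y f = (\<Sum>i\<le>k. smult (poly ((pderiv ^^ i) f) y / fact i) ([:-y, 1:] ^ i))"

definition rho :: "sobolev_data \<Rightarrow> real poly" where
  "rho D = (\<Prod>j=1..num D. [:-pt D j, 1:] ^ (ord_at D j + 1))"

(* Polynomial div, here and below, is only applied to exact quotients. *)
definition rho_jk :: "sobolev_data \<Rightarrow> nat \<Rightarrow> nat \<Rightarrow> real poly" where
  "rho_jk D j k = rho D div [:-pt D j, 1:] ^ (k + 1)"

definition rho_N :: "sobolev_data \<Rightarrow> real poly" where
  "rho_N D = (\<Prod>j=1..num D. [:-pt D j, 1:])"

definition rho_dN :: "sobolev_data \<Rightarrow> real poly" where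
  "rho_dN D = (\<Prod>j=1..num D. [:-pt D j, 1:] ^ ord_at D j)"

definition gamma1 :: "sobolev_data \<Rightarrow> nat \<Rightarrow> real" where
  "gamma1 D m = (let a = alpha D; b = beta D; s = 2 * real m + a + b in
     (b^2 - a^2) / (s * (s + 2)))"

(* For m = 1 the factor 1 + alpha + beta, which may vanish, is cancelled. *)
definition gamma2 :: "sobolev_data \<Rightarrow> nat \<Rightarrow> real" where
  "gamma2 D m = (let a = alpha D; b = beta D; s = 2 * real m + a + b in
     if m = 1 then 4 * (1 + a) * (1 + b) / (s^2 * (s + 1))
     else 4 * real m * (real m + a) * (real m + b) * (real m + a + b) / (s^2 * (s^2 - 1)))"

definition a_hat :: "sobolev_data \<Rightarrow> nat \<Rightarrow> real poly" where
  "a_hat D m = (let a = alpha D; b = beta D; s = 2 * real m + a + b in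
     smult (- (real m / s)) [:b - a, s:])"

definition b_hat :: "sobolev_data \<Rightarrow> nat \<Rightarrow> real" where
  "b_hat D m = (let a = alpha D; b = beta D; s = 2 * real m + a + b in
     if m = 1 then 4 * (1 + a) * (1 + b) / s^2
     else 4 * real m * (real m + a) * (real m + b) * (real m + a + b) / (s^2 * (s - 1)))"

definition c_hat :: "sobolev_data \<Rightarrow> nat \<Rightarrow> real poly" where
  "c_hat D m = (let a = alpha D; b = beta D; s = 2 * real m + a + b in
     smult ((real m + a + b) / s) [:a - b, s:])"

definition d_hat :: "sobolev_data \<Rightarrow> nat \<Rightarrow> real" where
  "d_hat D m = - (2 * real m + alpha D + beta D - 1)"

definition conn_coeff :: "sobolev_data \<Rightarrow> nat \<Rightarrow> nat \<Rightarrow> nat \<Rightarrow> real" where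
  "conn_coeff D m j k =
     fact k * mass D j k * poly ((pderiv ^^ k) (sobolev_S D m)) (pt D j) / jacobi_h D (m - 1)"

definition A2 :: "sobolev_data \<Rightarrow> nat \<Rightarrow> real poly" where
  "A2 D m = rho D - (\<Sum>(j, k)\<in>I_plus D.
     smult (conn_coeff D m j k) (taylor k (pt D j) (jacobi_P D (m - 1)) * rho_jk D j k))"

definition B2 :: "sobolev_data \<Rightarrow> nat \<Rightarrow> real poly" where
  "B2 D m = (\<Sum>(j, k)\<in>I_plus D.
     smult (conn_coeff D m j k) (taylor k (pt D j) (jacobi_P D m) * rho_jk D j k))"

definition A3 :: "sobolev_data \<Rightarrow> nat \<Rightarrow> real poly" where
  "A3 D m = [:1, 0, -1:] * pderiv (A2 D m) + a_hat D m * A2 D m + smult (d_hat D m) (B2 D m)"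

definition B3 :: "sobolev_data \<Rightarrow> nat \<Rightarrow> real poly" where
  "B3 D m = [:1, 0, -1:] * pderiv (B2 D m) + smult (b_hat D m) (A2 D m) + c_hat D m * B2 D m"

definition C2 :: "sobolev_data \<Rightarrow> nat \<Rightarrow> real poly" where
  "C2 D n = - smult (1 / gamma2 D (n - 1)) (B2 D (n - 1))"

definition D2 :: "sobolev_data \<Rightarrow> nat \<Rightarrow> real poly" where
  "D2 D n = A2 D (n - 1) +
     smult (1 / gamma2 D (n - 1)) (B2 D (n - 1) * [:- gamma1 D (n - 1), 1:])"

definition C3 :: "sobolev_data \<Rightarrow> nat \<Rightarrow> real poly" where
  "C3 D n = - smult (1 / gamma2 D (n - 1)) (B3 D (n - 1))"

definition D3 :: "sobolev_data \<Rightarrow> nat \<Rightarrow> real poly" where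
  "D3 D n = A3 D (n - 1) +
     smult (1 / gamma2 D (n - 1)) (B3 D (n - 1) * [:- gamma1 D (n - 1), 1:])"

definition Delta :: "sobolev_data \<Rightarrow> nat \<Rightarrow> real poly" where
  "Delta D n = A2 D n * D2 D n - C2 D n * B2 D n"

definition delta :: "sobolev_data \<Rightarrow> nat \<Rightarrow> real poly" where
  "delta D n = Delta D n div rho D"

definition phi1 :: "sobolev_data \<Rightarrow> nat \<Rightarrow> real poly" where
  "phi1 D n = (B3 D n * A2 D n - A3 D n * B2 D n) div rho_dN D"

definition phi2 :: "sobolev_data \<Rightarrow> nat \<Rightarrow> real poly" where
  "phi2 D n = (B3 D n * C2 D n - A3 D n * D2 D n) div rho_dN D"

definition phi3 :: "sobolev_data \<Rightarrow> nat \<Rightarrow> real poly" where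
  "phi3 D n = (B2 D n * C3 D n - A2 D n * D3 D n) div rho_dN D"

definition q0 :: "sobolev_data \<Rightarrow> nat \<Rightarrow> real poly" where
  "q0 D n = [:1, 0, -1:] * Delta D n"

definition q1 :: "sobolev_data \<Rightarrow> nat \<Rightarrow> real poly" where
  "q1 D n = B3 D n * A2 D n - A3 D n * B2 D n"

definition q2 :: "sobolev_data \<Rightarrow> nat \<Rightarrow> real poly" where
  "q2 D n = [:1, 0, -1:] * pderiv (rho D) * delta D n + B3 D n * C2 D n - A3 D n * D2 D n"

definition q3 :: "sobolev_data \<Rightarrow> nat \<Rightarrow> real poly" where
  "q3 D n = [:1, 0, -1:] * pderiv (rho D) * delta D n + C3 D n * B2 D n - D3 D n * A2 D n"

definition PP2 :: "sobolev_data \<Rightarrow> nat \<Rightarrow> real poly" where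
  "PP2 D n = q1 D n * (q0 D n)^2"

definition PP1 :: "sobolev_data \<Rightarrow> nat \<Rightarrow> real poly" where
  "PP1 D n = q0 D n * (q1 D n * q2 D n + q1 D n * q3 D n
                        + pderiv (q0 D n) * q1 D n - q0 D n * pderiv (q1 D n))"

definition psi1 :: "sobolev_data \<Rightarrow> nat \<Rightarrow> real poly" where
  "psi1 D n = phi2 D n + phi3 D n"

definition psi2 :: "sobolev_data \<Rightarrow> nat \<Rightarrow> real poly" where
  "psi2 D n = [:1, 0, -1:] * rho_N D * delta D n"

definition r_fun :: "sobolev_data \<Rightarrow> nat \<Rightarrow> real \<Rightarrow> real" where
  "r_fun D n t = poly (psi1 D n) t / poly (pderiv (psi2 D n)) t"

abbreviation cpoly :: "real poly \<Rightarrow> complex poly" where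
  "cpoly p \<equiv> map_poly complex_of_real p"

(* All complex zeros of p are real and simple, and z 1, ..., z m lists them
   without repetition. *)
definition simple_real_zeros :: "real poly \<Rightarrow> nat \<Rightarrow> (nat \<Rightarrow> real) \<Rightarrow> bool" where
  "simple_real_zeros p m z \<longleftrightarrow>
     inj_on z {1..m} \<and>
     {w. poly (cpoly p) w = 0} = (\<lambda>j. complex_of_real (z j)) ` {1..m} \<and>
     (\<forall>j\<in>{1..m}. order (z j) p = 1)"

(* A vector of R^n is a function nat => real read on {1..n}. As ln 0 = 0 and
   1 / 0 = 0, a term below whose value is mathematically infinite is read as 0; with a
   nonzero exponent such a term is unbounded nearby, so it has no partial derivative
   there. A term with exponent 0 is identically 0. *)

definition energy_F ::
  "sobolev_data \<Rightarrow> nat \<Rightarrow> real \<Rightarrow> real \<Rightarrow> (nat \<Rightarrow> real) \<Rightarrow> (nat \<Rightarrow> real) \<Rightarrow> real" where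
  "energy_F D n l1 l2 l3 w = 1 / 2 * (\<Sum>k=1..n.
      ln (1 / \<bar>1 - w k\<bar> powr l1) + ln (1 / \<bar>1 + w k\<bar> powr l2)
      + (\<Sum>j=1..num D. ln (1 / \<bar>pt D j - w k\<bar> powr l3 j)))"

definition energy_G ::
  "sobolev_data \<Rightarrow> nat \<Rightarrow> (nat \<Rightarrow> real) \<Rightarrow> (nat \<Rightarrow> real) \<Rightarrow>
   nat \<Rightarrow> (nat \<Rightarrow> complex) \<Rightarrow> (nat \<Rightarrow> nat) \<Rightarrow> (nat \<Rightarrow> real) \<Rightarrow> real" where
  "energy_G D n u l4 N1 e l5 w = 1 / 2 * (\<Sum>k=1..n.
      (\<Sum>j=1..total_order D. ln (1 / \<bar>u j - w k\<bar> powr l4 j))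
      + (\<Sum>j=1..N1. ln (cmod (e j - complex_of_real (w k)) ^ l5 j)))"

definition pair_energy :: "nat \<Rightarrow> (nat \<Rightarrow> real) \<Rightarrow> real" where
  "pair_energy n w = (\<Sum>(k, j)\<in>{(k, j). 1 \<le> k \<and> k < j \<and> j \<le> n}. ln (1 / \<bar>w j - w k\<bar>))"

definition has_partial ::
  "((nat \<Rightarrow> real) \<Rightarrow> real) \<Rightarrow> nat \<Rightarrow> real \<Rightarrow> (nat \<Rightarrow> real) \<Rightarrow> bool" where
  "has_partial f k v w \<longleftrightarrow> ((\<lambda>t. f (w(k := t))) has_real_derivative v) (at (w k))"

(* The second partial derivative of f in the k-th coordinate exists at w and equals v:
   g is the first partial derivative along the k-th coordinate line near w. *)
definition has_partial2 ::
  "((nat \<Rightarrow> real) \<Rightarrow> real) \<Rightarrow> nat \<Rightarrow> real \<Rightarrow> (nat \<Rightarrow> real) \<Rightarrow> bool" where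
  "has_partial2 f k v w \<longleftrightarrow>
     (\<exists>g. (\<forall>\<^sub>F t in nhds (w k). has_partial f k (g t) (w(k := t))) \<and>
          (g has_real_derivative v) (at (w k)))"

definition local_minimum :: "nat \<Rightarrow> ((nat \<Rightarrow> real) \<Rightarrow> real) \<Rightarrow> (nat \<Rightarrow> real) \<Rightarrow> bool" where
  "local_minimum n f x \<longleftrightarrow>
     (\<exists>\<epsilon>>0. \<forall>w. L2_set (\<lambda>k. w k - x k) {1..n} < \<epsilon> \<longrightarrow> f x \<le> f w)"

end

theory Submission
  imports Defs
begin

text \<open>
  Near an increasing configuration the pair energy lies above its linearisation, by
  \<open>ln y \<le> y - 1\<close> applied to each ratio of gaps. The external field is a sum of one
  function \<open>v\<close> over the coordinates, and a positive second derivative places \<open>v\<close> above its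
  tangent near each \<open>x k\<close>. Adding up, the energy lies locally above its linearisation at
  the critical point, which is constant.
\<close>

text \<open>By the mean value theorem \<open>v t - v a\<close> is \<open>g z\<close> times
  \<open>t - a\<close> for some \<open>z\<close> strictly between \<open>a\<close> and
  \<open>t\<close>. The derivative \<open>c > 0\<close> of \<open>g\<close> at \<open>a\<close>
  makes \<open>g z\<close> smaller than \<open>g a\<close> to the left of \<open>a\<close> and
  larger to the right. Only comparisons with \<open>g a\<close> enter, so \<open>v\<close> need not
  be convex near \<open>a\<close>.\<close>

lemma above_tangent_if_second_deriv_pos:
  fixes v g :: "real \<Rightarrow> real"
  assumes v: "\<forall>\<^sub>F t in nhds a. (v has_real_derivative g t) (at t)"
    and g: "(g has_real_derivative c) (at a)" and "c > 0"
  shows "\<forall>\<^sub>F t in nhds a. v a + g a * (t - a) \<le> v t"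
proof -
  obtain d1 where d1: "d1 > 0" "\<And>t. dist t a < d1 \<Longrightarrow> (v has_real_derivative g t) (at t)"
    using v unfolding eventually_nhds_metric by blast
  obtain d2 where d2: "d2 > 0" "\<And>h. h > 0 \<Longrightarrow> h < d2 \<Longrightarrow> g a < g (a + h)"
    using DERIV_pos_inc_right[OF g \<open>c > 0\<close>] by blast
  obtain d3 where d3: "d3 > 0" "\<And>h. h > 0 \<Longrightarrow> h < d3 \<Longrightarrow> g (a - h) < g a"
    using DERIV_pos_inc_left[OF g \<open>c > 0\<close>] by blast
  define d where "d = min d1 (min d2 d3)"
  have "v a + g a * (t - a) \<le> v t" if t: "dist t a < d" for t
  proof (cases t a rule: linorder_cases)
    case less
    have "\<And>s. t \<le> s \<Longrightarrow> s \<le> a \<Longrightarrow> (v has_real_derivative g s) (at s)"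
      using t by (intro d1) (auto simp: d_def dist_real_def)
    then obtain z where z: "t < z" "z < a" "v a - v t = (a - t) * g z"
      using MVT2[OF less] by blast
    have "g z \<le> g a"
      using d3(2)[of "a - z"] z t by (auto simp: d_def dist_real_def)
    then have "(a - t) * g z \<le> (a - t) * g a"
      using less by (intro mult_left_mono) auto
    with z show ?thesis by (simp add: algebra_simps)
  next
    case greater
    have "\<And>s. a \<le> s \<Longrightarrow> s \<le> t \<Longrightarrow> (v has_real_derivative g s) (at s)"
      using t by (intro d1) (auto simp: d_def dist_real_def)
    then obtain z where z: "a < z" "z < t" "v t - v a = (t - a) * g z"
      using MVT2[OF greater] by blast
    have "g a \<le> g z"
      using d2(2)[of "z - a"] z t by (auto simp: d_def dist_real_def)
    then have "(t - a) * g a \<le> (t - a) * g z"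
      using greater by (intro mult_left_mono) auto
    with z show ?thesis by (simp add: algebra_simps)
  qed auto
  moreover have "d > 0" using d1 d2 d3 by (simp add: d_def)
  ultimately show ?thesis unfolding eventually_nhds_metric by blast
qed

text \<open>Each coordinate deviation is at most the Euclidean distance, so finitely many
  coordinatewise neighbourhoods contain a common ball of the kind used in
  \<open>local_minimum\<close>.\<close>

lemma L2_ball_if_eventually_coordinates:
  fixes x :: "'i \<Rightarrow> real"
  assumes "finite I" and P: "\<forall>k\<in>I. \<forall>\<^sub>F t in nhds (x k). P k t"
  shows "\<exists>\<epsilon>>0. \<forall>w. L2_set (\<lambda>k. w k - x k) I < \<epsilon> \<longrightarrow> (\<forall>k\<in>I. P k (w k))"
proof -
  obtain d where d: "\<forall>k\<in>I. d k > 0 \<and> (\<forall>t. dist t (x k) < d k \<longrightarrow> P k t)"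
    using P unfolding eventually_nhds_metric by metis
  \<comment> \<open>The extra element 1 keeps the minimum meaningful when \<open>I\<close> is
    empty.\<close>
  define \<epsilon> where "\<epsilon> = Min (insert 1 (d ` I))"
  have "\<epsilon> > 0" using d \<open>finite I\<close> by (simp add: \<epsilon>_def)
  moreover have "P k (w k)" if w: "L2_set (\<lambda>k. w k - x k) I < \<epsilon>" and k: "k \<in> I" for w k
  proof -
    have "\<bar>w k - x k\<bar> \<le> L2_set (\<lambda>k. \<bar>w k - x k\<bar>) I"
      using member_le_L2_set[OF \<open>finite I\<close> k, of "\<lambda>k. \<bar>w k - x k\<bar>"] by simp
    also have "\<dots> = L2_set (\<lambda>k. w k - x k) I" by (simp add: L2_set_def)
    also have "\<dots> < d k"
      using w k \<open>finite I\<close> by (simp add: \<epsilon>_def)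
    finally show ?thesis using d k by (simp add: dist_real_def)
  qed
  ultimately show ?thesis by blast
qed

text \<open>The order of a vector relates two coordinates at a time. Midpoints replace it by
  conditions on single coordinates, which a ball around \<open>x\<close> can guarantee.\<close>

lemma eventually_between_midpoints:
  fixes x :: "nat \<Rightarrow> real"
  assumes "strict_mono_on {1..n} x" and k: "k \<in> {1..n}"
  shows "\<forall>\<^sub>F t in nhds (x k). \<forall>j\<in>{1..n}.
           (j < k \<longrightarrow> (x j + x k) / 2 < t) \<and> (k < j \<longrightarrow> t < (x j + x k) / 2)"
proof -
  have "\<forall>\<^sub>F t in nhds (x k).
          (j < k \<longrightarrow> (x j + x k) / 2 < t) \<and> (k < j \<longrightarrow> t < (x j + x k) / 2)" if j: "j \<in> {1..n}" for j
  proof (cases j k rule: linorder_cases)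
    case less
    with strict_mono_onD[OF assms(1) j k] have "(x j + x k) / 2 < x k" by simp
    then have "\<forall>\<^sub>F t in nhds (x k). (x j + x k) / 2 < t"
      by (rule order_tendstoD(1)[OF filterlim_ident])
    then show ?thesis by eventually_elim (use less in auto)
  next
    case greater
    with strict_mono_onD[OF assms(1) k j] have "x k < (x j + x k) / 2" by simp
    then have "\<forall>\<^sub>F t in nhds (x k). t < (x j + x k) / 2"
      by (rule order_tendstoD(2)[OF filterlim_ident])
    then show ?thesis by eventually_elim (use greater in auto)
  qed auto
  then show ?thesis by (simp add: eventually_ball_finite_distrib)
qed

text \<open>For \<open>x\<close> increasing on \<open>{1..n}\<close> this is the directional
  derivative of \<open>pair_energy n\<close> at \<open>x\<close> along \<open>h\<close>: each pair
  contributes the derivative of minus the logarithm of its gap.\<close>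

definition pair_energy_deriv :: "nat \<Rightarrow> (nat \<Rightarrow> real) \<Rightarrow> (nat \<Rightarrow> real) \<Rightarrow> real" where
  "pair_energy_deriv n x h =
     (\<Sum>(k, j)\<in>{(k, j). 1 \<le> k \<and> k < j \<and> j \<le> n}. - ((h j - h k) / (x j - x k)))"

lemma finite_index_pairs: "finite {(k, j). 1 \<le> k \<and> k < j \<and> j \<le> (n::nat)}"
  by (rule finite_subset[of _ "{1..n} \<times> {1..n}"]) auto

text \<open>Linearity in \<open>h\<close>, expanded in the standard basis. The coefficients are the
  partial derivatives of the pair energy, which is how the criticality condition meets the
  linearisation.\<close>

lemma pair_energy_deriv_expand:
  "pair_energy_deriv n x h = (\<Sum>i=1..n. h i * pair_energy_deriv n x (\<lambda>j. of_bool (j = i)))"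
proof -
  have h: "h k = (\<Sum>i=1..n. h i * of_bool (k = i))" if "k \<in> {1..n}" for k
    using that by (simp add: of_bool_def if_distrib sum.delta cong: if_cong)
  have "(\<Sum>i=1..n. h i * pair_energy_deriv n x (\<lambda>j. of_bool (j = i))) =
      (\<Sum>(k, j)\<in>{(k, j). 1 \<le> k \<and> k < j \<and> j \<le> n}.
         \<Sum>i=1..n. h i * - ((of_bool (j = i) - of_bool (k = i)) / (x j - x k)))"
    unfolding pair_energy_deriv_def sum_distrib_left
    by (subst sum.swap) (simp add: case_prod_unfold)
  also have "\<dots> = pair_energy_deriv n x h"
    unfolding pair_energy_deriv_def
  proof (intro sum.cong refl, clarify)
    fix k j assume kj: "1 \<le> k" "k < j" "j \<le> n"
    have "(\<Sum>i=1..n. h i * - ((of_bool (j = i) - of_bool (k = i)) / (x j - x k))) =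
        - (((\<Sum>i=1..n. h i * of_bool (j = i)) - (\<Sum>i=1..n. h i * of_bool (k = i))) / (x j - x k))"
      unfolding sum_subtractf[symmetric] sum_divide_distrib sum_negf[symmetric]
      by (intro sum.cong refl) (simp only: right_diff_distrib mult_minus_right times_divide_eq_right)
    also have "\<dots> = - ((h j - h k) / (x j - x k))"
      using h[of j] h[of k] kj by simp
    finally show "(\<Sum>i=1..n. h i * - ((of_bool (j = i) - of_bool (k = i)) / (x j - x k))) =
        - ((h j - h k) / (x j - x k))" .
  qed
  finally show ?thesis by simp
qed

lemma has_partial_pair_energy:
  assumes "strict_mono_on {1..n} x"
  shows "has_partial (pair_energy n) i (pair_energy_deriv n x (\<lambda>j. of_bool (j = i))) x"
proof -
  \<comment> \<open>Writing the derivative of every coordinate as \<open>of_bool (j = i)\<close>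
    treats pairs containing \<open>i\<close> first, second or not at all in one computation.\<close>
  have upd: "((\<lambda>t. (x(i := t)) j) has_real_derivative of_bool (j = i)) (at (x i))" for j
    by (cases "j = i") auto
  have "((\<lambda>t. ln (1 / \<bar>(x(i := t)) j - (x(i := t)) k\<bar>)) has_real_derivative
          - ((of_bool (j = i) - of_bool (k = i)) / (x j - x k))) (at (x i))"
    if kj: "1 \<le> k" "k < j" "j \<le> n" for k j
  proof -
    have pos: "x j - x k > 0" using strict_mono_onD[OF assms, of k j] kj by auto
    have gap: "((\<lambda>t. (x(i := t)) j - (x(i := t)) k) has_real_derivative
        of_bool (j = i) - of_bool (k = i)) (at (x i))"
      by (intro DERIV_diff upd)
    have "((\<lambda>t. - ln ((x(i := t)) j - (x(i := t)) k)) has_real_derivative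
        - (inverse (x j - x k) * (of_bool (j = i) - of_bool (k = i)))) (at (x i))"
      by (intro DERIV_minus DERIV_chain2[OF _ gap]) (use pos kj in \<open>simp add: DERIV_ln\<close>)
    moreover have "\<forall>\<^sub>F t in nhds (x i).
        - ln ((x(i := t)) j - (x(i := t)) k) = ln (1 / \<bar>(x(i := t)) j - (x(i := t)) k\<bar>)"
    proof -
      have "((\<lambda>t. (x(i := t)) j - (x(i := t)) k) \<longlongrightarrow> x j - x k) (nhds (x i))"
        using DERIV_isCont[OF gap, unfolded isCont_def, THEN tendsto_at_iff_tendsto_nhds[THEN iffD1]]
        by (simp only: fun_upd_triv)
      from order_tendstoD(1)[OF this pos] show ?thesis
        by eventually_elim (simp only: abs_of_pos ln_div ln_one, simp)
    qed
    ultimately show ?thesis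
      by (subst DERIV_cong_ev[OF refl _ refl, symmetric])
        (auto simp: divide_inverse mult.commute simp del: fun_upd_apply)
  qed
  then show ?thesis
    unfolding has_partial_def pair_energy_def pair_energy_deriv_def
    by (auto intro!: DERIV_sum simp: case_prod_unfold simp del: fun_upd_apply)
qed

text \<open>This is convexity of minus the logarithm, applied to the positive gap of each pair. It
  holds for every increasing \<open>w\<close>, not only for those close to \<open>x\<close>.\<close>

lemma pair_energy_above_linearisation:
  assumes x: "strict_mono_on {1..n} x" and w: "strict_mono_on {1..n} w"
  shows "pair_energy n x + pair_energy_deriv n x (\<lambda>k. w k - x k) \<le> pair_energy n w"
proof -
  have "ln (1 / \<bar>x j - x k\<bar>) + - ((w j - x j - (w k - x k)) / (x j - x k)) \<le> ln (1 / \<bar>w j - w k\<bar>)"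
    if kj: "1 \<le> k" "k < j" "j \<le> n" for k j
  proof -
    have pos: "x j - x k > 0" "w j - w k > 0"
      using strict_mono_onD[OF x, of k j] strict_mono_onD[OF w, of k j] kj by auto
    then have "ln ((w j - w k) / (x j - x k)) \<le> (w j - w k) / (x j - x k) - 1"
      by (intro ln_le_minus_one divide_pos_pos)
    also have "\<dots> = (w j - x j - (w k - x k)) / (x j - x k)"
      using pos by (simp add: field_simps)
    finally show ?thesis using pos by (simp add: ln_div)
  qed
  then show ?thesis
    unfolding pair_energy_def pair_energy_deriv_def sum.distrib[symmetric]
    by (intro order.trans[OF eq_refl sum_mono]) (auto simp: sum.distrib case_prod_unfold)
qed

text \<open>The pair energy lies above its linearisation on increasing vectors and \<open>V\<close>
  lies above its own near \<open>x\<close>; criticality makes the two linear terms cancel. As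
  \<open>V\<close> is separable, its pure second partials control it completely.\<close>

lemma local_minimum_pair_energy_separable:
  assumes x: "strict_mono_on {1..n} x"
    and V: "\<And>w. V w = (\<Sum>k=1..n. v (w k))"
    and crit: "\<forall>k\<in>{1..n}. has_partial (\<lambda>w. pair_energy n w + V w) k 0 x"
    and conv: "\<forall>k\<in>{1..n}. \<exists>c>0. has_partial2 V k c x"
  shows "local_minimum n (\<lambda>w. pair_energy n w + V w) x"
proof -
  define p where "p k = pair_energy_deriv n x (\<lambda>j. of_bool (j = k))" for k
  have tangent: "\<forall>\<^sub>F t in nhds (x k). v (x k) - p k * (t - x k) \<le> v t" if k: "k \<in> {1..n}" for k
  proof -
    obtain c g where "c > 0"
      and g: "\<forall>\<^sub>F t in nhds (x k). has_partial V k (g t) (x(k := t))"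
      and g': "(g has_real_derivative c) (at (x k))"
      using conv k unfolding has_partial2_def by blast
    \<comment> \<open>Along the \<open>k\<close>-th coordinate line \<open>V\<close> differs from
      \<open>v\<close> by a constant, so its partial derivatives there are exactly the derivatives
      of \<open>v\<close>.\<close>
    have V_line: "V (x(k := s)) = v s + (\<Sum>i\<in>{1..n} - {k}. v (x i))" for s
      unfolding V using k by (subst sum.remove[of _ k]) (auto intro!: sum.cong)
    have partial_iff: "has_partial V k b (x(k := t)) \<longleftrightarrow> (v has_real_derivative b) (at t)" for b t
    proof
      assume "has_partial V k b (x(k := t))"
      then have "((\<lambda>s. v s + (\<Sum>i\<in>{1..n} - {k}. v (x i))) has_real_derivative b) (at t)"
        by (simp add: has_partial_def V_line)
      from DERIV_diff[OF this DERIV_const[of "\<Sum>i\<in>{1..n} - {k}. v (x i)"]]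
      show "(v has_real_derivative b) (at t)" by simp
    next
      assume "(v has_real_derivative b) (at t)"
      from DERIV_add[OF this DERIV_const[of "\<Sum>i\<in>{1..n} - {k}. v (x i)"]]
      show "has_partial V k b (x(k := t))" by (simp add: has_partial_def V_line)
    qed
    \<comment> \<open>A property holding eventually in \<open>nhds (x k)\<close> holds at
      \<open>x k\<close> itself. Uniqueness of the derivative of the total energy then forces
      \<open>g (x k) = - p k\<close>.\<close>
    have "has_partial V k (g (x k)) x"
      using eventually_nhds_x_imp_x[OF g] by simp
    then have "has_partial (\<lambda>w. pair_energy n w + V w) k (p k + g (x k)) x"
      using has_partial_pair_energy[OF x, of k] unfolding has_partial_def p_def
      by (intro DERIV_add)
    then have "p k + g (x k) = 0"
      using crit k unfolding has_partial_def by (blast intro: DERIV_unique)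
    then have "g (x k) = - p k" by simp
    with above_tangent_if_second_deriv_pos[OF g[unfolded partial_iff] g' \<open>c > 0\<close>]
    show ?thesis by simp
  qed
  obtain \<epsilon> where "\<epsilon> > 0" and \<epsilon>: "\<And>w. L2_set (\<lambda>k. w k - x k) {1..n} < \<epsilon> \<Longrightarrow>
      \<forall>k\<in>{1..n}. v (x k) - p k * (w k - x k) \<le> v (w k) \<and> (\<forall>j\<in>{1..n}.
        (j < k \<longrightarrow> (x j + x k) / 2 < w k) \<and> (k < j \<longrightarrow> w k < (x j + x k) / 2))"
    using L2_ball_if_eventually_coordinates[where I = "{1..n}" and x = x and
        P = "\<lambda>k t. v (x k) - p k * (t - x k) \<le> v t \<and> (\<forall>j\<in>{1..n}.
          (j < k \<longrightarrow> (x j + x k) / 2 < t) \<and> (k < j \<longrightarrow> t < (x j + x k) / 2))"]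
      eventually_conj[OF tangent eventually_between_midpoints[OF x]] by blast
  have "pair_energy n x + V x \<le> pair_energy n w + V w"
    if near: "L2_set (\<lambda>k. w k - x k) {1..n} < \<epsilon>" for w
  proof -
    \<comment> \<open>Neighbouring values are separated by the midpoint of the corresponding entries
      of \<open>x\<close>. Hence no coordinates collide in the ball, and the default value of
      \<open>ln (1 / 0)\<close> never enters the pair energy.\<close>
    have w: "strict_mono_on {1..n} w"
    proof (rule strict_mono_onI)
      fix k j assume kj: "k \<in> {1..n}" "j \<in> {1..n}" "k < j"
      have "w k < (x j + x k) / 2" using \<epsilon>[OF near] kj by blast
      also have "\<dots> = (x k + x j) / 2" by simp
      also have "\<dots> < w j" using \<epsilon>[OF near] kj by blast
      finally show "w k < w j" .
    qed
    have "(\<Sum>k=1..n. v (x k) - p k * (w k - x k)) \<le> V w"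
      unfolding V using \<epsilon>[OF near] by (intro sum_mono) blast
    \<comment> \<open>The tangent slopes \<open>- p k\<close> add up to minus the directional
      derivative of the pair energy along \<open>w - x\<close>.\<close>
    then have "V x - pair_energy_deriv n x (\<lambda>k. w k - x k) \<le> V w"
      by (simp add: V p_def sum_subtractf mult.commute
          pair_energy_deriv_expand[of n x "\<lambda>k. w k - x k"])
    with pair_energy_above_linearisation[OF x w] show ?thesis by simp
  qed
  with \<open>\<epsilon> > 0\<close> show ?thesis unfolding local_minimum_def by blast
qed

theorem theorem5:
  fixes D :: sobolev_data and n N1 :: nat
    and x u l3 l4 :: "nat \<Rightarrow> real" and l1 l2 kappa1 :: real
    and e :: "nat \<Rightarrow> complex" and l5 :: "nat \<Rightarrow> nat"
    and E V F G :: "(nat \<Rightarrow> real) \<Rightarrow> real"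
  assumes "alpha D > -1" and "beta D > -1"
    and "inj_on (pt D) {1..num D}" and "\<forall>j\<in>{1..num D}. pt D j \<notin> {-1<..<1}"
    and "mono_on {1..num D} (ord_at D)"
    and "\<forall>j\<in>{1..num D}. \<forall>k\<le>ord_at D j. mass D j k \<ge> 0"
    and "\<forall>j\<in>{1..num D}. (j, ord_at D j) \<in> I_plus D"
    and "sequentially_ordered D"
    and "n \<ge> 2"
    and "strict_mono_on {1..n} x" and "simple_real_zeros (sobolev_S D n) n x"
    and "simple_real_zeros (delta D n) (total_order D) u"
    and "\<forall>j\<in>{1..total_order D}. \<forall>k\<in>{1..n}. u j \<noteq> x k"
    and "cpoly (phi1 D n) = smult (complex_of_real kappa1) (\<Prod>j=1..N1. [:- e j, 1:] ^ l5 j)"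
    and "kappa1 \<noteq> 0"
    and "\<forall>j\<in>{1..N1}. e j \<notin> complex_of_real ` (convex hull ({-1..1} \<union> pt D ` {1..num D}))"
    and "(\<Sum>j=1..N1. l5 j) = total_order D + num D"
    and "\<forall>z::complex. poly (cpoly (PP2 D n)) z \<noteq> 0 \<longrightarrow>
           poly (cpoly (PP1 D n)) z / poly (cpoly (PP2 D n)) z =
             complex_of_real l1 / (z - 1) + complex_of_real l2 / (z + 1)
             + (\<Sum>j=1..num D. complex_of_real (l3 j) / (z - complex_of_real (pt D j)))
             + (\<Sum>j=1..total_order D. complex_of_real (l4 j) / (z - complex_of_real (u j)))
             - (\<Sum>j=1..N1. of_nat (l5 j) / (z - e j))"
    and "l1 \<ge> 0" and "l2 \<ge> 0"
    and "\<forall>j\<in>{1..num D}. l3 j \<ge> 0" and "\<forall>j\<in>{1..total_order D}. l4 j \<ge> 0"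
    and "rsquarefree (cpoly (psi2 D n)) \<longrightarrow>
           l1 = 1 + r_fun D n 1 \<and> l2 = 1 + r_fun D n (-1) \<and>
           (\<forall>j\<in>{1..num D}. l3 j = 2 * real (ord_at D j) + r_fun D n (pt D j) + 3) \<and>
           (\<forall>j\<in>{1..total_order D}. l4 j = r_fun D n (u j) + 1)"
    and F_eq: "F = energy_F D n l1 l2 l3"
    and G_eq: "G = energy_G D n u l4 N1 e l5"
    and V_eq: "V = (\<lambda>w. F w + G w)"
    and E_eq: "E = (\<lambda>w. pair_energy n w + V w)"
    and critical: "\<forall>k\<in>{1..n}. has_partial E k 0 x"
    and convex: "\<forall>k\<in>{1..n}. \<exists>vF vG. has_partial2 F k vF x \<and> has_partial2 G k vG x \<and>
                   has_partial2 V k (vF + vG) x \<and> vF + vG > 0"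
  shows "local_minimum n E x"
proof -
  define v where "v t = 1 / 2 *
      (ln (1 / \<bar>1 - t\<bar> powr l1) + ln (1 / \<bar>1 + t\<bar> powr l2)
        + (\<Sum>j=1..num D. ln (1 / \<bar>pt D j - t\<bar> powr l3 j)))
      + 1 / 2 * ((\<Sum>j=1..total_order D. ln (1 / \<bar>u j - t\<bar> powr l4 j))
        + (\<Sum>j=1..N1. ln (cmod (e j - complex_of_real t) ^ l5 j)))" for t
  \<comment> \<open>Regrouping finite sums gives this for every \<open>w\<close>, also where a
    logarithm takes its default value.\<close>
  have "V w = (\<Sum>k=1..n. v (w k))" for w
    unfolding V_eq F_eq G_eq energy_F_def energy_G_def v_def
    by (simp add: sum.distrib distrib_left sum_distrib_left)
  moreover have "\<forall>k\<in>{1..n}. \<exists>c>0. has_partial2 V k c x"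
    using convex by blast
  ultimately show ?thesis
    using local_minimum_pair_energy_separable[OF \<open>strict_mono_on {1..n} x\<close>] critical
    unfolding E_eq by blast
qed

end
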